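(* Let $I\subset\mathbb R$ be an open interval, $k:I\to\mathbb R$ a smooth function and $b<c<d<n$ points of $I$ such that $$\{x\in I:k'(x)\le0\}=[c,d],\qquad\{x\in I:k'(x)=0\}=\{c,d\},\qquad k(c)<k(n).$$ Then there are a path $(k_t)_{t\in\mathbb R}$ of smooth functions on $I$ from $k_0=k$ to $k_\infty=k_2$ and $t_0\in\,]1,2[$ such that: (1) for all $t\le t'$, $k_t\le k_{t'}$, with equality at every $x\notin\,]b,n[$; (2) if $0<t<t_0$, $k_t$ is a Morse function, and if $t_0<t$, $\{x\in I:k_t'(x)\le0\}=\emptyset$; (3) near $[c,d]$ and for $t\ge1$, $k_t$ is the restriction of a cubic polynomial.
   Context: A path of functions from $k_0=k$ to $k_\infty=k_2$ is a family $(k_t)_{t\in\mathbb R}$ such that $(t,x)\mapsto k_t(x)$ is smooth, $k_t=k_0$ for $t\le0$ and $k_t=k_2$ for $t\ge2$. A Morse function is one all of whose critical points are non-degenerate. *)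

theory Defs
  imports "HOL-Analysis.Analysis" "HOL-Computational_Algebra.Polynomial"
begin

text \<open>
  Differentiability of class $C^k$ on an open set: the derivative at points of \<open>S\<close> is the
  two-sided one, so these notions are meant for open \<open>S\<close> in a finite-dimensional space, where
  $C^{k+1}$ means differentiable with all directional derivatives of class $C^k$.
\<close>

primrec k_times_differentiable_on ::
  "nat \<Rightarrow> ('a::real_normed_vector \<Rightarrow> 'b::real_normed_vector) \<Rightarrow> 'a set \<Rightarrow> bool" where
  "k_times_differentiable_on 0 f S \<longleftrightarrow> continuous_on S f"
| "k_times_differentiable_on (Suc k) f S \<longleftrightarrow>
     (\<forall>x\<in>S. f differentiable (at x)) \<and>
     (\<forall>v. k_times_differentiable_on k (\<lambda>x. frechet_derivative f (at x) v) S)"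

definition smooth_on ::
  "('a::real_normed_vector \<Rightarrow> 'b::real_normed_vector) \<Rightarrow> 'a set \<Rightarrow> bool" where
  "smooth_on f S \<longleftrightarrow> (\<forall>k. k_times_differentiable_on k f S)"

definition Morse_on :: "(real \<Rightarrow> real) \<Rightarrow> real set \<Rightarrow> bool" where
  "Morse_on f I \<longleftrightarrow>
     smooth_on f I \<and> (\<forall>x\<in>I. deriv f x = 0 \<longrightarrow> deriv (deriv f) x \<noteq> 0)"

text \<open>
  Functions on \<open>I\<close> are total functions whose values outside \<open>I\<close> are irrelevant; hence all
  equalities of functions are asserted on \<open>I\<close> only.
\<close>

definition function_path :: "real set \<Rightarrow> (real \<Rightarrow> real \<Rightarrow> real) \<Rightarrow> bool" where
  "function_path I K \<longleftrightarrow>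
     smooth_on (\<lambda>(t, x). K t x) (UNIV \<times> I) \<and>
     (\<forall>t\<le>0. \<forall>x\<in>I. K t x = K 0 x) \<and>
     (\<forall>t\<ge>2. \<forall>x\<in>I. K t x = K 2 x)"

end

theory Submission
  imports Defs
begin

text \<open>
  The path consists of two affine deformations run one after the other, and all conditions are
  checked on derivatives. During $0 \le t \le 1$ the function $k$ moves on a segment to a function
  $F_0$ which increases strictly off $[c,d]$ and equals a cubic with derivative $A(x-c)(x-d)$ near
  $[c,d]$. Both ends of the segment have a positive derivative off $[c,d]$ and a derivative
  $\le 0$ on it, so the critical points stay $c$ and $d$; there $k'' \le 0$ and
  $k'' \ge 0$ respectively, with strict inequalities for $F_0$, so they become non-degenerate at
  once. During $1 \le t \le 2$ the cubic is tilted: $F_0$ moves to $F_\beta$, whose derivative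
  near $[c,d]$ is $A((x-c)(x-d)+\beta)$ and which remains strictly increasing off $[c,d]$. The two
  critical points merge and vanish when $\beta = (d-c)^2/4$; if $\beta$ runs up to
  $(d-c)^2/2$ along the symmetric smooth step, this happens at $t_0 = 3/2$.

  The family $F_\beta$ is built in \<open>cubic_replacement\<close>. As the path has to increase, the cubic
  must lie above $k$, yet $F_\beta$ must rejoin $k$ at $n$. Fix $m$ in $]d,n[$ with
  $k(c) < k(m)$, and a small $\delta > 0$. The comparison function $Q$ is $k+\delta$ up to $m$,
  and over $[m,n]$ the excess $\delta$ fades out so slowly that $Q$ still increases. The
  cubic is chosen so flat that on $[b,n]$ it stays in $[k(m), k(m)+\delta/3]$; it then lies above
  $k$ on $[b,m]$ and below $Q$ shortly before $m$. Hence $k$, the cubic and $Q$ can be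
  glued in this order, each time passing to a larger function along an increasing step, which
  keeps the derivative positive (\<open>glue_has_pos_derivative\<close>).
\<close>

section \<open>Closure properties of smooth functions\<close>

lemma k_times_differentiable_on_cong:
  assumes "open S" "\<And>x. x \<in> S \<Longrightarrow> f x = g x" "k_times_differentiable_on k f S"
  shows "k_times_differentiable_on k g S"
  using assms(2,3)
proof (induction k arbitrary: f g)
  case 0
  then show ?case by (auto cong: continuous_on_cong)
next
  case (Suc k)
  have D: "(g has_derivative frechet_derivative f (at x)) (at x)" if "x \<in> S" for x
    using Suc.prems that \<open>open S\<close> 
    by (auto simp: frechet_derivative_works intro: has_derivative_transform_within_open)
  have E: "frechet_derivative g (at x) = frechet_derivative f (at x)" if "x \<in> S" for x
    using frechet_derivative_at[OF D[OF that]] by simp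
  have "k_times_differentiable_on k (\<lambda>x. frechet_derivative g (at x) v) S" for v
    by (rule Suc.IH[of "\<lambda>x. frechet_derivative f (at x) v"]) (use Suc.prems E in auto)
  then show ?case using D by (auto simp: differentiable_def)
qed

text \<open>The shape in which all the closure properties below are proved: exhibit the
  derivative and check that it is $k$ times differentiable.\<close>

lemma k_times_differentiable_on_SucI:
  assumes "open S" "\<And>x. x \<in> S \<Longrightarrow> (f has_derivative f' x) (at x)"
    "\<And>v. k_times_differentiable_on k (\<lambda>x. f' x v) S"
  shows "k_times_differentiable_on (Suc k) f S"
proof -
  have E: "frechet_derivative f (at x) = f' x" if "x \<in> S" for x
    using frechet_derivative_at[OF assms(2)[OF that]] by simp
  have "k_times_differentiable_on k (\<lambda>x. frechet_derivative f (at x) v) S" for v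
    by (rule k_times_differentiable_on_cong[OF assms(1) _ assms(3)[of v]]) (simp add: E)
  with assms(2) show ?thesis by (auto simp: differentiable_def)
qed

lemma k_times_differentiable_on_SucD:
  assumes "k_times_differentiable_on (Suc k) f S"
  shows "k_times_differentiable_on k f S"
  using assms
proof (induction k arbitrary: f)
  case 0
  then show ?case
    by (auto intro!: continuous_at_imp_continuous_on differentiable_imp_continuous_within)
next
  case (Suc k)
  then have "k_times_differentiable_on k (\<lambda>x. frechet_derivative f (at x) v) S" for v
    by (metis k_times_differentiable_on.simps(2))
  with Suc.prems show ?case by simp
qed

lemma k_times_differentiable_on_has_derivative:
  assumes "k_times_differentiable_on (Suc k) f S" "x \<in> S"
  shows "(f has_derivative frechet_derivative f (at x)) (at x)"
  using assms by (simp add: frechet_derivative_works)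

lemma k_times_differentiable_on_const:
  assumes "open S" shows "k_times_differentiable_on k (\<lambda>x. a) S"
proof (induction k arbitrary: a)
  case (Suc k)
  show ?case
    by (rule k_times_differentiable_on_SucI[OF assms, where f' = "\<lambda>x v. 0"]) (auto intro: Suc)
qed simp

lemma k_times_differentiable_on_add:
  assumes "open S" "k_times_differentiable_on k f S" "k_times_differentiable_on k g S"
  shows "k_times_differentiable_on k (\<lambda>x. f x + g x) S"
  using assms(2,3)
proof (induction k arbitrary: f g)
  case 0
  then show ?case by (auto intro: continuous_intros)
next
  case (Suc k)
  show ?case
    by (rule k_times_differentiable_on_SucI[OF assms(1), where
          f' = "\<lambda>x v. frechet_derivative f (at x) v + frechet_derivative g (at x) v"])
       (use Suc in \<open>auto intro!: has_derivative_add k_times_differentiable_on_has_derivative\<close>)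
qed

lemma k_times_differentiable_on_mult:
  fixes f g :: "'a::real_normed_vector \<Rightarrow> 'b::real_normed_algebra"
  assumes "open S" "k_times_differentiable_on k f S" "k_times_differentiable_on k g S"
  shows "k_times_differentiable_on k (\<lambda>x. f x * g x) S"
  using assms(2,3)
proof (induction k arbitrary: f g)
  case 0
  then show ?case by (auto intro: continuous_intros)
next
  case (Suc k)
  note [simp del] = k_times_differentiable_on.simps(2)
  have fg: "k_times_differentiable_on k f S" "k_times_differentiable_on k g S"
    using Suc.prems by (auto intro: k_times_differentiable_on_SucD)
  have D: "k_times_differentiable_on k (\<lambda>x. frechet_derivative f (at x) v) S"
      "k_times_differentiable_on k (\<lambda>x. frechet_derivative g (at x) v) S" for v
    using Suc.prems by (auto simp: k_times_differentiable_on.simps)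
  show ?case
    by (rule k_times_differentiable_on_SucI[OF assms(1), where
          f' = "\<lambda>x v. f x * frechet_derivative g (at x) v + frechet_derivative f (at x) v * g x"])
       (use Suc fg D in \<open>auto intro!: has_derivative_mult
          k_times_differentiable_on_has_derivative k_times_differentiable_on_add assms(1)\<close>)
qed

lemma k_times_differentiable_on_inverse:
  fixes f :: "'a::real_normed_vector \<Rightarrow> real"
  assumes "open S" "\<And>x. x \<in> S \<Longrightarrow> f x \<noteq> 0" "k_times_differentiable_on k f S"
  shows "k_times_differentiable_on k (\<lambda>x. inverse (f x)) S"
  using assms(3)
proof (induction k)
  case 0
  then show ?case using assms(2) by (auto intro: continuous_intros)
next
  case (Suc k)
  have I: "k_times_differentiable_on k (\<lambda>x. inverse (f x)) S"
    using Suc k_times_differentiable_on_SucD by blast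
  have D: "k_times_differentiable_on k (\<lambda>x. frechet_derivative f (at x) v) S" for v
    using Suc.prems by auto
  show ?case
  proof (rule k_times_differentiable_on_SucI[OF assms(1)])
    fix x assume x: "x \<in> S"
    show "((\<lambda>x. inverse (f x)) has_derivative
        (\<lambda>v. (-1) * (inverse (f x) * frechet_derivative f (at x) v * inverse (f x)))) (at x)"
      using Deriv.has_derivative_inverse[OF assms(2)[OF x]
          k_times_differentiable_on_has_derivative[OF Suc.prems x]] by simp
  next
    fix v
    show "k_times_differentiable_on k
        (\<lambda>x. (-1) * (inverse (f x) * frechet_derivative f (at x) v * inverse (f x))) S"
      by (intro k_times_differentiable_on_mult k_times_differentiable_on_const assms(1) I D)
  qed
qed

lemma k_times_differentiable_on_compose_affine:
  assumes "bounded_linear L" "open T" "\<And>z. z \<in> T \<Longrightarrow> a + L z \<in> S"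
    "k_times_differentiable_on k f S"
  shows "k_times_differentiable_on k (\<lambda>z. f (a + L z)) T"
  using assms(4)
proof (induction k arbitrary: f)
  case 0
  have "continuous_on T (\<lambda>z. a + L z)"
    by (intro continuous_intros bounded_linear.continuous_on[OF assms(1)])
  then show ?case using 0 assms(3) by (auto intro: continuous_on_compose2)
next
  case (Suc k)
  show ?case
  proof (rule k_times_differentiable_on_SucI[OF assms(2)])
    fix z assume z: "z \<in> T"
    have "((\<lambda>z. a + L z) has_derivative L) (at z)"
      using bounded_linear_imp_has_derivative[OF assms(1), of "at z"]
      by (auto intro!: derivative_eq_intros)
    from has_derivative_compose[OF this
        k_times_differentiable_on_has_derivative[OF Suc.prems assms(3)[OF z]]]
    show "((\<lambda>z. f (a + L z)) has_derivative
        (\<lambda>v. frechet_derivative f (at (a + L z)) (L v))) (at z)" .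
  next
    fix v
    show "k_times_differentiable_on k (\<lambda>z. frechet_derivative f (at (a + L z)) (L v)) T"
      by (rule Suc.IH) (use Suc.prems in simp)
  qed
qed

lemma smooth_on_const: "open S \<Longrightarrow> smooth_on (\<lambda>x. a) S"
  by (simp add: smooth_on_def k_times_differentiable_on_const)

lemma smooth_on_add:
  "open S \<Longrightarrow> smooth_on f S \<Longrightarrow> smooth_on g S \<Longrightarrow> smooth_on (\<lambda>x. f x + g x) S"
  by (simp add: smooth_on_def k_times_differentiable_on_add)

lemma smooth_on_mult:
  fixes f g :: "'a::real_normed_vector \<Rightarrow> 'b::real_normed_algebra"
  shows "open S \<Longrightarrow> smooth_on f S \<Longrightarrow> smooth_on g S \<Longrightarrow> smooth_on (\<lambda>x. f x * g x) S"
  by (simp add: smooth_on_def k_times_differentiable_on_mult)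

lemma smooth_on_diff:
  fixes f g :: "'a::real_normed_vector \<Rightarrow> 'b::real_normed_algebra_1"
  assumes "open S" "smooth_on f S" "smooth_on g S"
  shows "smooth_on (\<lambda>x. f x - g x) S"
  using smooth_on_add[OF assms(1,2) smooth_on_mult[OF assms(1) smooth_on_const[OF assms(1), of "-1"] assms(3)]]
  by simp

lemma smooth_on_power:
  fixes f :: "'a::real_normed_vector \<Rightarrow> 'b::real_normed_algebra_1"
  shows "open S \<Longrightarrow> smooth_on f S \<Longrightarrow> smooth_on (\<lambda>x. f x ^ m) S"
  by (induction m) (auto intro: smooth_on_const smooth_on_mult)

lemma smooth_on_divide:
  fixes f g :: "'a::real_normed_vector \<Rightarrow> real"
  assumes "open S" "smooth_on f S" "smooth_on g S" "\<And>x. x \<in> S \<Longrightarrow> g x \<noteq> 0"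
  shows "smooth_on (\<lambda>x. f x / g x) S"
  using assms unfolding divide_inverse
  by (intro smooth_on_mult) (auto simp: smooth_on_def k_times_differentiable_on_inverse)

lemma smooth_on_compose_affine:
  assumes "bounded_linear L" "open T" "smooth_on f S" "\<And>z. z \<in> T \<Longrightarrow> a + L z \<in> S"
  shows "smooth_on (\<lambda>z. f (a + L z)) T"
  using assms(3) unfolding smooth_on_def
  by (blast intro: k_times_differentiable_on_compose_affine[OF assms(1,2,4)])

lemma smooth_on_ident: "open S \<Longrightarrow> smooth_on (\<lambda>x. x) S"
  unfolding smooth_on_def
proof
  fix k assume S: "open S"
  show "k_times_differentiable_on k (\<lambda>x. x) S"
  proof (cases k)
    case (Suc j)
    show ?thesis unfolding Suc
      by (rule k_times_differentiable_on_SucI[OF S, where f' = "\<lambda>x v. v"])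
         (auto intro: k_times_differentiable_on_const S)
  qed simp
qed

lemma smooth_on_deriv:
  fixes f :: "real \<Rightarrow> real"
  assumes "smooth_on f S" "x \<in> S"
  shows "(f has_real_derivative deriv f x) (at x)"
proof -
  have "f differentiable (at x)"
    using assms by (metis smooth_on_def k_times_differentiable_on.simps(2))
  then show ?thesis
    using DERIV_deriv_iff_real_differentiable by blast
qed

lemma smooth_on_imp_smooth_on_deriv:
  fixes f :: "real \<Rightarrow> real"
  assumes "open S" "smooth_on f S"
  shows "smooth_on (deriv f) S"
  unfolding smooth_on_def
proof
  fix k
  have D: "k_times_differentiable_on k (\<lambda>x. frechet_derivative f (at x) 1) S"
    using assms(2) by (metis smooth_on_def k_times_differentiable_on.simps(2))
  have E: "frechet_derivative f (at x) 1 = deriv f x" if "x \<in> S" for x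
  proof -
    have "(f has_derivative (*) (deriv f x)) (at x)"
      using smooth_on_deriv[OF assms(2) that] by (simp add: has_field_derivative_def)
    from frechet_derivative_at[OF this] show ?thesis by (metis mult.right_neutral)
  qed
  show "k_times_differentiable_on k (deriv f) S"
    by (rule k_times_differentiable_on_cong[OF assms(1) E D])
qed

lemma smooth_on_imp_continuous_on: "smooth_on f S \<Longrightarrow> continuous_on S f"
  by (metis smooth_on_def k_times_differentiable_on.simps(1))

lemmas smooth_on_intros = smooth_on_const smooth_on_ident smooth_on_add smooth_on_diff
  smooth_on_mult smooth_on_power

section \<open>Smooth steps\<close>

text \<open>The flat function $x \mapsto p(1/x)\,e^{-1/x}$ for $x > 0$, extended by $0$. With a
  polynomial factor \<open>p\<close> the class is closed under differentiation.\<close>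

definition flat :: "real poly \<Rightarrow> real \<Rightarrow> real" where
  "flat p x = (if x \<le> 0 then 0 else poly p (1 / x) * exp (- (1 / x)))"

lemma tendsto_poly_times_exp_minus: "((\<lambda>u::real. poly p u * exp (- u)) \<longlongrightarrow> 0) at_top"
proof -
  have "((\<lambda>u. \<Sum>i\<le>degree p. coeff p i * (u ^ i / exp u)) \<longlongrightarrow> (\<Sum>i\<le>degree p. coeff p i * 0)) at_top"
    by (intro tendsto_intros tendsto_power_div_exp_0)
  moreover have "(\<Sum>i\<le>degree p. coeff p i * (u ^ i / exp u)) = poly p u * exp (- u)" for u
    by (simp add: poly_altdef sum_distrib_right exp_minus divide_inverse mult.assoc)
  ultimately show ?thesis by simp
qed

lemma flat_tendsto_0_right: "(flat p \<longlongrightarrow> 0) (at_right 0)"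
proof -
  have "((\<lambda>x. poly p (inverse x) * exp (- inverse x)) \<longlongrightarrow> 0) (at_right 0)"
    by (rule filterlim_compose[OF tendsto_poly_times_exp_minus filterlim_inverse_at_top_right])
  then show ?thesis
    by (rule Lim_transform_eventually)
       (auto simp: eventually_at_right_field flat_def divide_inverse intro: exI[of _ 1])
qed

lemma flat_has_real_derivative:
  "(flat p has_real_derivative flat ([:0, 0, 1:] * (p - pderiv p)) x) (at x)"
proof -
  consider "x < 0" | "x = 0" | "x > 0" by linarith
  then show ?thesis
  proof cases
    case 1
    have "((\<lambda>x. 0) has_real_derivative 0) (at x)" by simp
    then have "(flat p has_real_derivative 0) (at x)"
      by (rule has_field_derivative_transform_within_open[of _ _ _ "{..<0}"])
         (use 1 in \<open>auto simp: flat_def\<close>)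
    with 1 show ?thesis by (simp add: flat_def)
  next
    case 2
    have "((\<lambda>h. flat p h / h) \<longlongrightarrow> 0) (at_left 0)"
      by (rule Lim_transform_eventually[OF tendsto_const])
         (auto simp: eventually_at_left_field flat_def intro: exI[of _ "-1"])
    moreover have "((\<lambda>h. flat p h / h) \<longlongrightarrow> 0) (at_right 0)"
      by (rule Lim_transform_eventually[OF flat_tendsto_0_right[of "pCons 0 p"]])
         (auto simp: eventually_at_right_field flat_def intro: exI[of _ 1])
    ultimately have "((\<lambda>h. flat p h / h) \<longlongrightarrow> 0) (at 0)"
      by (simp add: filterlim_at_split)
    with 2 show ?thesis by (simp add: DERIV_def flat_def)
  next
    case 3
    have inv: "((\<lambda>x. 1 / x) has_real_derivative - (1 / x\<^sup>2)) (at x)"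
      using 3 by (auto intro!: derivative_eq_intros simp: power2_eq_square)
    have "((\<lambda>x. poly p (1 / x) * exp (- (1 / x))) has_real_derivative
        poly (pderiv p) (1 / x) * - (1 / x\<^sup>2) * exp (- (1 / x))
          + exp (- (1 / x)) * - (- (1 / x\<^sup>2)) * poly p (1 / x)) (at x)"
      by (intro DERIV_mult DERIV_chain2[OF poly_DERIV inv] DERIV_chain2[OF DERIV_exp]
          DERIV_minus inv)
    also have "poly (pderiv p) (1 / x) * - (1 / x\<^sup>2) * exp (- (1 / x))
          + exp (- (1 / x)) * - (- (1 / x\<^sup>2)) * poly p (1 / x)
        = flat ([:0, 0, 1:] * (p - pderiv p)) x"
      using 3 by (simp add: flat_def algebra_simps power2_eq_square)
    finally have "((\<lambda>x. poly p (1 / x) * exp (- (1 / x))) has_real_derivative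
        flat ([:0, 0, 1:] * (p - pderiv p)) x) (at x)" .
    then show ?thesis
      by (rule has_field_derivative_transform_within_open[of _ _ _ "{0<..}"])
         (use 3 in \<open>auto simp: flat_def\<close>)
  qed
qed

lemma smooth_on_flat: "smooth_on (flat p) UNIV"
  unfolding smooth_on_def
proof
  fix k show "k_times_differentiable_on k (flat p) UNIV"
  proof (induction k arbitrary: p)
    case 0
    show ?case using flat_has_real_derivative
      by (auto intro!: continuous_at_imp_continuous_on DERIV_isCont)
  next
    case (Suc k)
    show ?case
      by (rule k_times_differentiable_on_SucI[OF open_UNIV
            flat_has_real_derivative[unfolded has_field_derivative_def]])
         (intro k_times_differentiable_on_mult k_times_differentiable_on_const Suc open_UNIV)
  qed
qed

text \<open>A smooth monotone step: $0$ for $x \le 0$, $1$ for $x \ge 1$, with value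
  $1/2$ at $1/2$ and nowhere else.\<close>

definition unit_step :: "real \<Rightarrow> real" where
  "unit_step x = flat 1 x / (flat 1 x + flat 1 (1 - x))"

lemma flat_1_nonneg: "0 \<le> flat 1 x"
  by (simp add: flat_def)

lemma flat_1_mono: "x \<le> y \<Longrightarrow> flat 1 x \<le> flat 1 y"
  by (auto simp: flat_def frac_le)

lemma flat_1_strict_mono: "x < y \<Longrightarrow> 0 < y \<Longrightarrow> flat 1 x < flat 1 y"
  by (auto simp: flat_def field_simps)

lemma unit_step_denominator_pos: "0 < flat 1 x + flat 1 (1 - x)"
  by (cases "x > 0") (auto simp: flat_def intro: add_pos_nonneg)

lemma smooth_on_unit_step: "smooth_on unit_step UNIV"
proof -
  have "smooth_on (\<lambda>x. flat 1 (1 + - x)) UNIV"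
    by (rule smooth_on_compose_affine[OF _ open_UNIV smooth_on_flat])
       (auto intro: bounded_linear_minus bounded_linear_ident)
  then show ?thesis
    unfolding unit_step_def [abs_def]
    using unit_step_denominator_pos
    by (intro smooth_on_divide smooth_on_add open_UNIV smooth_on_flat)
       (auto simp: less_imp_neq[symmetric])
qed

lemma unit_step_nonneg: "0 \<le> unit_step x"
  by (simp add: unit_step_def flat_1_nonneg)

lemma unit_step_le_1: "unit_step x \<le> 1"
  using unit_step_denominator_pos[of x] flat_1_nonneg[of "1 - x"] by (simp add: unit_step_def)

lemma unit_step_eq_0: "x \<le> 0 \<Longrightarrow> unit_step x = 0"
  by (simp add: unit_step_def flat_def)

lemma unit_step_eq_1: "1 \<le> x \<Longrightarrow> unit_step x = 1"
  by (simp add: unit_step_def flat_def)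

lemma unit_step_pos: "0 < x \<Longrightarrow> 0 < unit_step x"
  using unit_step_denominator_pos[of x] by (simp add: unit_step_def) (simp add: flat_def)

lemma unit_step_mono: assumes "x \<le> y" shows "unit_step x \<le> unit_step y"
proof -
  have "flat 1 x * flat 1 (1 - y) \<le> flat 1 y * flat 1 (1 - x)"
    using assms by (intro mult_mono flat_1_mono flat_1_nonneg) auto
  then show ?thesis
    using unit_step_denominator_pos[of x] unit_step_denominator_pos[of y]
    by (simp add: unit_step_def divide_simps algebra_simps)
qed

lemma unit_step_less_half: assumes "x < 1/2" shows "unit_step x < 1/2"
  using flat_1_strict_mono[of x "1 - x"] unit_step_denominator_pos[of x] assms
  by (simp add: unit_step_def divide_simps)

lemma unit_step_greater_half: assumes "1/2 < x" shows "1/2 < unit_step x"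
  using flat_1_strict_mono[of "1 - x" x] unit_step_denominator_pos[of x] assms
  by (simp add: unit_step_def divide_simps)

text \<open>The step rescaled to climb from $0$ to $1$ over the interval \<open>{p..q}\<close>.\<close>

definition step :: "real \<Rightarrow> real \<Rightarrow> real \<Rightarrow> real" where
  "step p q x = unit_step ((x - p) / (q - p))"

lemma step_nonneg: "0 \<le> step p q x" and step_le_1: "step p q x \<le> 1"
  by (simp_all add: step_def unit_step_nonneg unit_step_le_1)

lemma step_eq_0: "p < q \<Longrightarrow> x \<le> p \<Longrightarrow> step p q x = 0"
  by (simp add: step_def unit_step_eq_0 divide_nonpos_pos)

lemma step_eq_1: "p < q \<Longrightarrow> q \<le> x \<Longrightarrow> step p q x = 1"
  by (simp add: step_def unit_step_eq_1)

lemma smooth_on_step: "open S \<Longrightarrow> smooth_on (step p q) S"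
proof -
  assume S: "open S"
  have "smooth_on (\<lambda>x. unit_step (- p / (q - p) + x / (q - p))) S"
    by (rule smooth_on_compose_affine[OF _ S smooth_on_unit_step])
       (auto intro: bounded_linear_divide)
  then show ?thesis by (simp add: step_def[abs_def] diff_divide_distrib)
qed

lemma step_has_deriv: "(step p q has_real_derivative deriv (step p q) x) (at x)"
  using smooth_on_deriv[OF smooth_on_step[OF open_UNIV]] by simp

lemma deriv_step_nonneg: "p < q \<Longrightarrow> 0 \<le> deriv (step p q) x"
  by (rule mono_on_imp_deriv_nonneg[OF _ step_has_deriv, of UNIV])
     (auto simp: step_def intro!: mono_onI unit_step_mono divide_right_mono)

lemma deriv_step_eq_0:
  assumes "p < q" "x \<le> p \<or> q \<le> x" shows "deriv (step p q) x = 0"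
proof (cases "x \<le> p")
  case True
  with assms show ?thesis
    by (intro DERIV_local_min[OF step_has_deriv zero_less_one]) (simp add: step_eq_0 step_nonneg)
next
  case False
  with assms show ?thesis
    by (intro DERIV_local_max[OF step_has_deriv zero_less_one]) (simp add: step_eq_1 step_le_1)
qed

section \<open>Replacing the decreasing part by a cubic\<close>

text \<open>Gluing along an increasing step preserves a positive derivative, provided that the
  function switched on lies above the function switched off wherever the step really moves:
  the extra term in the derivative is $\psi'(g - f)$.\<close>

lemma glue_has_pos_derivative:
  fixes f g \<psi> :: "real \<Rightarrow> real"
  assumes "(f has_real_derivative f') (at x)" "(g has_real_derivative g') (at x)"
    and "(\<psi> has_real_derivative \<psi>') (at x)" "0 \<le> \<psi>'" "0 \<le> \<psi> x" "\<psi> x \<le> 1"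
    and "\<psi> x < 1 \<Longrightarrow> 0 < f'" "0 < \<psi> x \<Longrightarrow> 0 < g'" "0 < \<psi>' \<Longrightarrow> f x \<le> g x"
  shows "\<exists>D. ((\<lambda>y. (1 - \<psi> y) * f y + \<psi> y * g y) has_real_derivative D) (at x) \<and> 0 < D"
proof (intro exI conjI)
  show "((\<lambda>y. (1 - \<psi> y) * f y + \<psi> y * g y) has_real_derivative
      (1 - \<psi> x) * f' + \<psi> x * g' + \<psi>' * (g x - f x)) (at x)"
    using assms(1-3) by (auto intro!: derivative_eq_intros simp: algebra_simps)
  have "0 \<le> \<psi>' * (g x - f x)"
    using assms(4,9) by (cases "\<psi>' = 0") auto
  moreover have "0 < (1 - \<psi> x) * f' + \<psi> x * g'"
  proof (cases "\<psi> x < 1")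
    case True
    then show ?thesis using assms(5,7,8)
      by (cases "\<psi> x = 0") (auto intro!: add_pos_pos)
  next
    case False
    then have "\<psi> x = 1" using assms(6) by simp
    then show ?thesis using assms(8) by simp
  qed
  ultimately show "0 < (1 - \<psi> x) * f' + \<psi> x * g' + \<psi>' * (g x - f x)" by simp
qed

text \<open>The functions $F_\beta = k + W + \beta V$ with $W, V \ge 0$ supported in $[b,n]$. That the
  family is affine in $\beta$, with the same gluing for all $\beta$, is what makes the path smooth
  and monotone in the time parameter.\<close>

lemma cubic_replacement:
  fixes k :: "real \<Rightarrow> real"
  assumes I: "open I" "is_interval I" and k: "smooth_on k I"
    and bn: "b \<in> I" "n \<in> I" "b < c" "c < d" "d < n"
    and pos: "\<And>x. x \<in> I \<Longrightarrow> x \<notin> {c..d} \<Longrightarrow> 0 < deriv k x"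
    and nonpos: "\<And>x. x \<in> {c..d} \<Longrightarrow> deriv k x \<le> 0"
    and zero: "deriv k c = 0" "deriv k d = 0"
    and kcn: "k c < k n" and "0 \<le> \<beta>1"
  obtains W V :: "real \<Rightarrow> real" and u w A e :: real
  where "smooth_on W I" "smooth_on V I"
    and "\<And>x. x \<in> I \<Longrightarrow> 0 \<le> W x" "\<And>x. x \<in> I \<Longrightarrow> 0 \<le> V x"
    and "\<And>x. x \<in> I \<Longrightarrow> x \<notin> {b<..<n} \<Longrightarrow> W x = 0"
    and "\<And>x. x \<in> I \<Longrightarrow> x \<notin> {b<..<n} \<Longrightarrow> V x = 0"
    and "{c..d} \<subseteq> {u<..<w}" "{u<..<w} \<subseteq> I" "0 < A"
    and "\<And>\<beta> x. x \<in> {u<..<w} \<Longrightarrow>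
      k x + W x + \<beta> * V x = e + A * (x ^ 3 / 3 - (c + d) / 2 * x\<^sup>2 + c * d * x + \<beta> * (x - b))"
    and "\<And>\<beta> x. 0 \<le> \<beta> \<Longrightarrow> \<beta> \<le> \<beta>1 \<Longrightarrow> x \<in> I \<Longrightarrow> x \<notin> {c..d} \<Longrightarrow>
      0 < deriv (\<lambda>x. k x + W x + \<beta> * V x) x"
proof -
  have bnI: "{b..n} \<subseteq> I"
    using mem_is_interval_1_I[OF I(2) bn(1,2)] by auto
  have kD: "(k has_real_derivative deriv k x) (at x)" if "x \<in> I" for x
    using smooth_on_deriv[OF k that] .
  have kcont: "continuous_on S k" if "S \<subseteq> I" for S
    using continuous_on_subset[OF smooth_on_imp_continuous_on[OF k] that] .
  have k'cont: "continuous_on S (deriv k)" if "S \<subseteq> I" for S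
    using continuous_on_subset[OF smooth_on_imp_continuous_on[OF
          smooth_on_imp_smooth_on_deriv[OF I(1) k]] that] .
  have k'ge: "0 \<le> deriv k x" if "x \<in> {b..c} \<union> {d..n}" for x
  proof (cases "x \<in> {c, d}")
    case True
    then show ?thesis using zero by auto
  next
    case False
    then have "x \<in> I" "x \<notin> {c..d}" using that bnI bn by auto
    then show ?thesis using pos less_imp_le by blast
  qed
  have k_inc_left: "k x \<le> k c" if "b \<le> x" "x \<le> c" for x
  proof (rule DERIV_nonneg_imp_nondecreasing[where f = k])
    fix y assume y: "x \<le> y" "y \<le> c"
    then have "y \<in> I" using that bn bnI by (auto simp: subset_iff)
    moreover have "0 \<le> deriv k y" by (rule k'ge) (use y that bn in auto)
    ultimately show "\<exists>D. (k has_real_derivative D) (at y) \<and> 0 \<le> D"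
      using kD by blast
  qed (use that in simp)
  have k_dec: "k x \<le> k c" if "c \<le> x" "x \<le> d" for x
  proof (rule DERIV_nonpos_imp_nonincreasing[where f = k])
    fix y assume y: "c \<le> y" "y \<le> x"
    then have "y \<in> I" using that bn bnI by (auto simp: subset_iff)
    moreover have "deriv k y \<le> 0" by (rule nonpos) (use y that bn in auto)
    ultimately show "\<exists>D. (k has_real_derivative D) (at y) \<and> D \<le> 0"
      using kD by blast
  qed (use that in simp)
  have k_inc_right: "k x \<le> k y" if "d \<le> x" "x \<le> y" "y \<le> n" for x y
  proof (rule DERIV_nonneg_imp_nondecreasing[where f = k])
    fix z assume z: "x \<le> z" "z \<le> y"
    then have "z \<in> I" using that bn bnI by (auto simp: subset_iff)
    moreover have "0 \<le> deriv k z" by (rule k'ge) (use z that bn in auto)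
    ultimately show "\<exists>D. (k has_real_derivative D) (at z) \<and> 0 \<le> D"
      using kD by blast
  qed (use that in simp)
  have kdc: "k d \<le> k c" using k_dec bn by simp

  \<comment> \<open>\<open>m\<close> is where the cubic is left for good, and \<open>\<delta>\<close> the height of the plateau \<open>k + \<delta>\<close>\<close>
  obtain m where m: "d < m" "m < n" "k c < k m"
  proof -
    have "\<exists>x\<ge>d. x \<le> n \<and> k x = (k c + k n) / 2"
      by (rule IVT') (use kcn kdc bn bnI in \<open>auto intro!: kcont\<close>)
    then obtain x where x: "d \<le> x" "x \<le> n" "k x = (k c + k n) / 2" by blast
    moreover have "x \<noteq> d" "x \<noteq> n" using x(3) kcn kdc by auto
    ultimately show thesis using kcn by (intro that[of x]) auto
  qed
  have km: "k x \<le> k m" if "b \<le> x" "x \<le> m" for x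
    using k_inc_left[of x] k_dec[of x] k_inc_right[of x m] that m by linarith

  obtain \<delta> where \<delta>: "0 < \<delta>"
    and \<delta>_step: "\<And>x. x \<in> {m..n} \<Longrightarrow> \<delta> * deriv (step m n) x < deriv k x"
  proof -
    have "\<exists>y\<in>{m..n}. \<forall>x\<in>{m..n}. deriv k y \<le> deriv k x"
      by (rule continuous_attains_inf) (use m bn bnI in \<open>auto intro!: k'cont\<close>)
    then obtain y where y: "y \<in> {m..n}" "\<And>x. x \<in> {m..n} \<Longrightarrow> deriv k y \<le> deriv k x" by blast
    have \<mu>: "0 < deriv k y" using y(1) m bn bnI by (intro pos) auto
    have "continuous_on {m..n} (deriv (step m n))"
      by (rule continuous_on_subset[OF smooth_on_imp_continuous_on[OF
          smooth_on_imp_smooth_on_deriv[OF open_UNIV smooth_on_step[OF open_UNIV]]]]) simp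
    then have "\<exists>z\<in>{m..n}. \<forall>x\<in>{m..n}. deriv (step m n) x \<le> deriv (step m n) z"
      by (intro continuous_attains_sup) (use m in auto)
    then obtain z where z: "\<And>x. x \<in> {m..n} \<Longrightarrow> deriv (step m n) x \<le> deriv (step m n) z"
      by blast
    define L where "L = deriv (step m n) z"
    have L: "0 \<le> L" unfolding L_def using m by (intro deriv_step_nonneg) simp
    show thesis
    proof (rule that[of "deriv k y / (L + 1)"])
      show "0 < deriv k y / (L + 1)" using \<mu> L by simp
      fix x assume x: "x \<in> {m..n}"
      have "deriv k y / (L + 1) * deriv (step m n) x \<le> deriv k y / (L + 1) * L"
        using z[OF x] \<mu> L by (intro mult_left_mono) (auto simp: L_def)
      also have "\<dots> < deriv k y" using \<mu> L by (simp add: field_simps)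
      also have "\<dots> \<le> deriv k x" using y(2)[OF x] .
      finally show "deriv k y / (L + 1) * deriv (step m n) x < deriv k x" .
    qed
  qed

  \<comment> \<open>the cubic to be used has values up to \<open>k m + \<delta> / 3\<close>, hence lies below \<open>k + \<delta>\<close> on \<open>{r..m}\<close>\<close>
  obtain r where r: "d < r" "r < m" "k m - \<delta> / 3 \<le> k r"
  proof -
    define h where "h = min (\<delta> / 3) ((k m - k d) / 2)"
    have h: "0 < h" "h \<le> \<delta> / 3" "h < k m - k d"
      using \<delta> m kdc by (auto simp: h_def min_def)
    have "\<exists>x\<ge>d. x \<le> m \<and> k x = k m - h"
      by (rule IVT') (use h m bn bnI in \<open>auto intro!: kcont\<close>)
    then obtain x where x: "d \<le> x" "x \<le> m" "k x = k m - h" by blast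
    moreover have "x \<noteq> d" "x \<noteq> m" using x(3) h by auto
    ultimately show thesis using h by (intro that[of x]) auto
  qed

  \<comment> \<open>\<open>A\<close> is so small that the cubics \<open>R \<beta>\<close> stay between \<open>k m\<close> and \<open>k m + \<delta> / 3\<close> on \<open>{b..n}\<close>\<close>
  define q where "q x = x ^ 3 / 3 - (c + d) / 2 * x\<^sup>2 + c * d * x" for x
  obtain C where C: "0 < C" "\<And>x. x \<in> {b..n} \<Longrightarrow> \<bar>q x\<bar> \<le> C"
  proof -
    have "compact (q ` {b..n})"
      by (intro compact_continuous_image) (auto simp: q_def [abs_def] intro!: continuous_intros)
    then show thesis using that
      by (force dest!: compact_imp_bounded simp: bounded_pos)
  qed
  define M where "M = 2 * C + \<beta>1 * (n - b)"
  have M: "0 < M"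
    unfolding M_def using C(1) \<open>0 \<le> \<beta>1\<close> bn by (intro add_pos_nonneg) auto
  define A where "A = \<delta> / (3 * M)"
  have A: "0 < A" "A * M = \<delta> / 3"
    using \<delta> M by (auto simp: A_def)
  define R where "R \<beta> x = k m + A * (C + q x + \<beta> * (x - b))" for \<beta> x
  have R: "k m \<le> R \<beta> x" "R \<beta> x \<le> k m + \<delta> / 3"
    if "0 \<le> \<beta>" "\<beta> \<le> \<beta>1" "x \<in> {b..n}" for \<beta> x
  proof -
    have q: "\<bar>q x\<bar> \<le> C" using C(2) that by blast
    have 0: "0 \<le> \<beta> * (x - b)" using that by simp
    have 1: "\<beta> * (x - b) \<le> \<beta>1 * (n - b)" using that by (intro mult_mono) auto
    have "A * (C + q x + \<beta> * (x - b)) \<le> A * M"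
      using A(1) q 1 by (intro mult_left_mono) (auto simp: M_def)
    then show "R \<beta> x \<le> k m + \<delta> / 3" using A(2) by (simp add: R_def)
    show "k m \<le> R \<beta> x" using A(1) q 0 by (simp add: R_def)
  qed
  have RD: "(R \<beta> has_real_derivative A * ((x - c) * (x - d) + \<beta>)) (at x)" for \<beta> x
    unfolding R_def q_def
    by (auto intro!: derivative_eq_intros simp: algebra_simps power2_eq_square)

  define p where "p = (b + c) / 2"
  have p: "b < p" "p < c" using bn by (auto simp: p_def)
  define \<phi> where "\<phi> = step b p"
  define \<psi> where "\<psi> = step r m"
  define Q where "Q x = k x + \<delta> * (1 - step m n x)" for x
  define E where "E \<beta> x = (1 - \<psi> x) * R \<beta> x + \<psi> x * Q x" for \<beta> x
  define W where "W x = \<phi> x * ((1 - \<psi> x) * (R 0 x - k x) + \<psi> x * (Q x - k x))" for x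
  define V where "V x = \<phi> x * ((1 - \<psi> x) * (A * (x - b)))" for x
  have KWV: "k x + W x + \<beta> * V x = (1 - \<phi> x) * k x + \<phi> x * E \<beta> x" for \<beta> x
    by (simp add: W_def V_def E_def R_def algebra_simps)

  have \<phi>D: "(\<phi> has_real_derivative deriv \<phi> x) (at x)" and \<psi>D: "(\<psi> has_real_derivative deriv \<psi> x) (at x)" for x
    unfolding \<phi>_def \<psi>_def by (rule step_has_deriv)+
  have QD: "(Q has_real_derivative deriv k x - \<delta> * deriv (step m n) x) (at x)" if "x \<in> I" for x
    unfolding Q_def by (auto intro!: derivative_eq_intros kD[OF that] step_has_deriv)
  have Q': "0 < deriv k x - \<delta> * deriv (step m n) x" if "x \<in> I" "d < x" for x
  proof (cases "x \<in> {m..n}")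
    case True then show ?thesis using \<delta>_step by simp
  next
    case False
    then have "deriv (step m n) x = 0" using m by (intro deriv_step_eq_0) auto
    then show ?thesis using pos that by simp
  qed
  have Qk: "k x \<le> Q x" for x
    using \<delta> by (simp add: Q_def step_le_1)

  \<comment> \<open>the second gluing \<open>E \<beta>\<close>, from the cubic to \<open>Q\<close>; left of \<open>b\<close> it is multiplied by \<open>\<phi> = 0\<close>
    and only needs to be differentiable\<close>
  have E': "\<exists>D. (E \<beta> has_real_derivative D) (at x) \<and> (b < x \<longrightarrow> 0 < D)"
    if \<beta>: "0 \<le> \<beta>" "\<beta> \<le> \<beta>1" and x: "x \<in> I" "x \<notin> {c..d}" for \<beta> x
  proof (cases "b < x")
    case True
    have "0 < (x - c) * (x - d)" using x(2) bn(4) by (auto simp: zero_less_mult_iff)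
    then have R': "0 < A * ((x - c) * (x - d) + \<beta>)" using A(1) \<beta> by simp
    have Q'': "0 < deriv k x - \<delta> * deriv (step m n) x" if "0 < \<psi> x"
    proof -
      have "r < x" using that r step_eq_0[of r m x] unfolding \<psi>_def by force
      then show ?thesis using Q' x r by auto
    qed
    have RQ: "R \<beta> x \<le> Q x" if "0 < deriv \<psi> x"
    proof -
      have xr: "r < x" "x < m" using that r deriv_step_eq_0[of r m x] unfolding \<psi>_def by force+
      have "R \<beta> x \<le> k m + \<delta> / 3" using R(2)[OF \<beta>] xr True m by auto
      also have "\<dots> \<le> k r + \<delta>" using r(3) \<delta> by linarith
      also have "\<dots> \<le> k x + \<delta>" using k_inc_right[of r x] xr r m by simp
      also have "\<dots> = Q x" using xr m by (simp add: Q_def step_eq_0)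
      finally show ?thesis .
    qed
    have "0 \<le> deriv \<psi> x" "0 \<le> \<psi> x" "\<psi> x \<le> 1"
      using r by (simp_all add: \<psi>_def step_nonneg step_le_1 deriv_step_nonneg)
    from glue_has_pos_derivative[where f = "R \<beta>", OF RD QD[OF x(1)] \<psi>D this] R' Q'' RQ
    show ?thesis unfolding E_def by auto
  next
    case False
    have "\<exists>D. (E \<beta> has_real_derivative D) (at x)" unfolding E_def
      using RD[of \<beta> x] QD[OF x(1)] \<psi>D[of x] by (fast intro: derivative_intros)
    with False show ?thesis by blast
  qed
  \<comment> \<open>the first gluing, from \<open>k\<close> to \<open>E \<beta>\<close>\<close>
  have F': "0 < deriv (\<lambda>x. k x + W x + \<beta> * V x) x"
    if \<beta>: "0 \<le> \<beta>" "\<beta> \<le> \<beta>1" and x: "x \<in> I" "x \<notin> {c..d}" for \<beta> x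
  proof -
    obtain D where D: "(E \<beta> has_real_derivative D) (at x)" "b < x \<Longrightarrow> 0 < D"
      using E'[OF \<beta> x] by blast
    have D': "0 < D" if "0 < \<phi> x"
      using D(2) that p step_eq_0[of b p x] unfolding \<phi>_def by force
    have kE: "k x \<le> E \<beta> x" if "0 < deriv \<phi> x"
    proof -
      have xb: "b < x" "x < p" using that p deriv_step_eq_0[of b p x] unfolding \<phi>_def by force+
      then have "E \<beta> x = R \<beta> x" using r p bn by (simp add: E_def \<psi>_def step_eq_0)
      moreover have "k m \<le> R \<beta> x" using xb p bn by (intro R(1)[OF \<beta>]) auto
      moreover have "k x \<le> k m" using xb p bn m by (intro km) auto
      ultimately show ?thesis by simp
    qed
    have "0 \<le> deriv \<phi> x" "0 \<le> \<phi> x" "\<phi> x \<le> 1"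
      using p by (simp_all add: \<phi>_def step_nonneg step_le_1 deriv_step_nonneg)
    from glue_has_pos_derivative[OF kD[OF x(1)] D(1) \<phi>D this] pos[OF x] D' kE
    obtain D2 where "((\<lambda>y. (1 - \<phi> y) * k y + \<phi> y * E \<beta> y) has_real_derivative D2) (at x)" "0 < D2"
      by auto
    then show ?thesis unfolding KWV using DERIV_imp_deriv by metis
  qed
  have xb: "\<phi> x = 0" if "x \<le> b" for x
    using that p by (simp add: \<phi>_def step_eq_0)
  have xm: "\<psi> x = 1" if "m \<le> x" for x
    using that r by (simp add: \<psi>_def step_eq_1)
  have \<phi>01: "0 \<le> \<phi> x" and \<psi>01: "0 \<le> \<psi> x" "\<psi> x \<le> 1" for x
    by (simp_all add: \<phi>_def \<psi>_def step_nonneg step_le_1)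
  show thesis
  proof (rule that[of W V p r A "k m + A * C"])
    have "smooth_on (step a a') I" for a a'
      using smooth_on_step[OF I(1)] .
    moreover have "smooth_on (R 0) I"
      unfolding R_def [abs_def] q_def [abs_def] power2_eq_square divide_inverse
      by (intro smooth_on_intros I(1))
    ultimately show "smooth_on W I" "smooth_on V I"
      unfolding W_def [abs_def] V_def [abs_def] Q_def [abs_def] \<phi>_def \<psi>_def
      by (auto intro!: smooth_on_intros I(1) k)
    show "0 \<le> W x" if "x \<in> I" for x
    proof (cases "b < x \<and> x < m")
      case True
      then have "k x \<le> R 0 x" using km[of x] R(1)[of 0 x] m \<open>0 \<le> \<beta>1\<close> by auto
      then show ?thesis using Qk[of x] \<phi>01[of x] \<psi>01[of x] by (simp add: W_def)
    next
      case False
      then show ?thesis using xb[of x] xm[of x] Qk[of x] \<phi>01[of x] by (force simp: W_def not_less)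
    qed
    show "0 \<le> V x" if "x \<in> I" for x
      using xb[of x] A(1) \<phi>01[of x] \<psi>01[of x] by (cases "x \<le> b") (auto simp: V_def)
    show "W x = 0" "V x = 0" if "x \<in> I" "x \<notin> {b<..<n}" for x
      using that xb[of x] xm[of x] m by (auto simp: W_def V_def Q_def step_eq_1)
    show "{c..d} \<subseteq> {p<..<r}" using p r by auto
    show "{p<..<r} \<subseteq> I" using p r m bnI by auto
    show "0 < A" by fact
    show "k x + W x + \<beta> * V x =
        k m + A * C + A * (x ^ 3 / 3 - (c + d) / 2 * x\<^sup>2 + c * d * x + \<beta> * (x - b))"
      if "x \<in> {p<..<r}" for \<beta> x
    proof -
      have "\<phi> x = 1" "\<psi> x = 0" using that p r by (auto simp: \<phi>_def \<psi>_def step_eq_0 step_eq_1)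
      then show ?thesis unfolding KWV by (simp add: E_def R_def q_def algebra_simps)
    qed
  qed (rule F')
qed

section \<open>The path of functions\<close>

lemma has_deriv_nonpos_if_decreasing_through:
  assumes "(f has_real_derivative l) (at c)" "c < d" "\<And>x. c < x \<Longrightarrow> x < d \<Longrightarrow> f x \<le> f c"
  shows "l \<le> 0"
proof (rule ccontr)
  assume "\<not> l \<le> 0"
  then obtain e where e: "e > 0" "\<And>h. 0 < h \<Longrightarrow> h < e \<Longrightarrow> f c < f (c + h)"
    using has_real_derivative_pos_inc_right[OF assms(1)] by auto
  define h where "h = min e (d - c) / 2"
  have "0 < h" "h < e" "h < d - c" using e(1) assms(2) by (auto simp: h_def min_def field_simps)
  then show False using e(2)[of h] assms(3)[of "c + h"] by force
qed

lemma has_deriv_nonneg_if_increasing_through: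
  assumes "(f has_real_derivative l) (at c)" "c < d" "\<And>x. c < x \<Longrightarrow> x < d \<Longrightarrow> f c \<le> f x"
  shows "0 \<le> l"
  using has_deriv_nonpos_if_decreasing_through[of "\<lambda>x. - f x" "- l" c d] assms
  by (auto intro: DERIV_minus)

theorem mainTheorem10:
  fixes I :: "real set" and k :: "real \<Rightarrow> real" and b c d n :: real
  assumes "open I" and "is_interval I"
    and "smooth_on k I"
    and "b \<in> I" and "c \<in> I" and "d \<in> I" and "n \<in> I"
    and "b < c" and "c < d" and "d < n"
    and "{x \<in> I. deriv k x \<le> 0} = {c..d}"
    and "{x \<in> I. deriv k x = 0} = {c, d}"
    and "k c < k n"
  shows "\<exists>(K :: real \<Rightarrow> real \<Rightarrow> real) (t0 :: real).
      function_path I K \<and> (\<forall>x\<in>I. K 0 x = k x) \<and>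
      1 < t0 \<and> t0 < 2 \<and>
      (\<forall>t t'. t \<le> t' \<longrightarrow>
         (\<forall>x\<in>I. K t x \<le> K t' x) \<and>
         (\<forall>x\<in>I - {b<..<n}. K t x = K t' x)) \<and>
      (\<forall>t. 0 < t \<and> t < t0 \<longrightarrow> Morse_on (K t) I) \<and>
      (\<forall>t. t0 < t \<longrightarrow> {x \<in> I. deriv (K t) x \<le> 0} = {}) \<and>
      (\<exists>U. open U \<and> {c..d} \<subseteq> U \<and> U \<subseteq> I \<and>
         (\<forall>t\<ge>1. \<exists>p :: real poly. degree p = 3 \<and> (\<forall>x\<in>U. K t x = poly p x)))"
proof -
  note I = \<open>open I\<close> and k = \<open>smooth_on k I\<close>
  have nonpos_iff: "x \<in> I \<and> deriv k x \<le> 0 \<longleftrightarrow> x \<in> {c..d}" for x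
    using assms(11) by blast
  have zero_iff: "x \<in> I \<and> deriv k x = 0 \<longleftrightarrow> x = c \<or> x = d" for x
    using assms(12) by blast
  have pos: "0 < deriv k x" if "x \<in> I" "x \<notin> {c..d}" for x
    using nonpos_iff[of x] that by linarith
  have nonpos: "deriv k x \<le> 0" if "x \<in> {c..d}" for x
    using nonpos_iff[of x] that by simp
  have zero: "deriv k c = 0" "deriv k d = 0"
    using zero_iff[of c] zero_iff[of d] by simp_all
  define \<beta>1 where "\<beta>1 = (d - c)\<^sup>2 / 2"
  have \<beta>1: "0 < \<beta>1" using \<open>c < d\<close> by (simp add: \<beta>1_def)
  obtain W V :: "real \<Rightarrow> real" and u w A e :: real
    where WV: "smooth_on W I" "smooth_on V I"
      and nonneg: "\<And>x. x \<in> I \<Longrightarrow> 0 \<le> W x" "\<And>x. x \<in> I \<Longrightarrow> 0 \<le> V x"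
      and supp: "\<And>x. x \<in> I \<Longrightarrow> x \<notin> {b<..<n} \<Longrightarrow> W x = 0"
        "\<And>x. x \<in> I \<Longrightarrow> x \<notin> {b<..<n} \<Longrightarrow> V x = 0"
      and uw: "{c..d} \<subseteq> {u<..<w}" "{u<..<w} \<subseteq> I" and A: "0 < A"
      and cubic: "\<And>\<beta> x. x \<in> {u<..<w} \<Longrightarrow> k x + W x + \<beta> * V x
        = e + A * (x ^ 3 / 3 - (c + d) / 2 * x\<^sup>2 + c * d * x + \<beta> * (x - b))"
      and off_pos: "\<And>\<beta> x. 0 \<le> \<beta> \<Longrightarrow> \<beta> \<le> \<beta>1 \<Longrightarrow> x \<in> I \<Longrightarrow> x \<notin> {c..d} \<Longrightarrow>
        0 < deriv (\<lambda>x. k x + W x + \<beta> * V x) x"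
  proof -
    show thesis
      by (rule cubic_replacement[OF assms(1-4,7-10), of \<beta>1])
         (fact pos nonpos zero assms(13) less_imp_le[OF \<beta>1] that)+
  qed

  define F where "F \<beta> x = k x + W x + \<beta> * V x" for \<beta> x
  define s where "s = unit_step"
  define \<beta> where "\<beta> t = \<beta>1 * s (t - 1)" for t
  define K where "K t x = k x + s t * (W x + \<beta> t * V x)" for t x
  \<comment> \<open>\<open>\<beta> t = 0\<close> for \<open>t \<le> 1\<close> and \<open>s t = 1\<close> for \<open>t \<ge> 1\<close>: the tilting starts when \<open>k\<close> is replaced\<close>
  note s_simps = unit_step_nonneg unit_step_le_1 unit_step_eq_0 unit_step_eq_1
  have s01: "0 \<le> s t" "s t \<le> 1" for t by (simp_all add: s_def s_simps)
  have \<beta>01: "0 \<le> \<beta> t" "\<beta> t \<le> \<beta>1" for t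
    using \<beta>1 s01[of "t - 1"] by (simp_all add: \<beta>_def mult_le_cancel_left1)
  have \<beta>_eq_0: "\<beta> t = 0" if "t \<le> 1" for t
    using that by (simp add: \<beta>_def s_def s_simps)
  have s_eq_1: "s t = 1" if "1 \<le> t" for t
    using that by (simp add: s_def s_simps)
  have KF: "K t x = (1 - s t) * k x + s t * F (\<beta> t) x" for t x
    by (simp add: K_def F_def algebra_simps)

  have smooth: "smooth_on (\<lambda>(t, x). K t x) (UNIV \<times> I)"
  proof -
    have S: "open ((UNIV :: real set) \<times> I)" by (intro open_Times I) simp
    have x: "smooth_on (\<lambda>z. f (snd z)) ((UNIV :: real set) \<times> I)" if "smooth_on f I" for f :: "real \<Rightarrow> real"
      using smooth_on_compose_affine[OF bounded_linear_snd S that, of 0] by auto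
    have t: "smooth_on (\<lambda>z. s (a + fst z)) ((UNIV :: real set) \<times> I)" for a
      by (rule smooth_on_compose_affine[OF bounded_linear_fst S smooth_on_unit_step[folded s_def]]) simp
    have "smooth_on (\<lambda>z. k (snd z) + s (0 + fst z) * (W (snd z) + \<beta>1 * s (-1 + fst z) * V (snd z)))
        ((UNIV :: real set) \<times> I)"
      by (intro smooth_on_intros S x t k WV)
    also have "(\<lambda>z. k (snd z) + s (0 + fst z) * (W (snd z) + \<beta>1 * s (-1 + fst z) * V (snd z)))
        = (\<lambda>(t, x). K t x)"
      by (auto simp: fun_eq_iff K_def \<beta>_def)
    finally show ?thesis .
  qed
  have smooth_K: "smooth_on (K t) I" for t
    unfolding K_def by (intro smooth_on_intros I k WV)
  have path: "function_path I K"
    unfolding function_path_def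
    by (intro conjI smooth) (auto simp: K_def \<beta>_def s_def s_simps)
  have mono: "K t x \<le> K t' x" if "t \<le> t'" "x \<in> I" for t t' x
  proof -
    have "s t \<le> s t'" "\<beta> t \<le> \<beta> t'"
      using that(1) \<beta>1 by (auto simp: s_def \<beta>_def intro!: mult_left_mono unit_step_mono)
    then show ?thesis unfolding K_def using nonneg[OF that(2)] s01 \<beta>01
      by (intro add_left_mono mult_mono mult_right_mono) auto
  qed
  have fixed: "K t x = K t' x" if "x \<in> I - {b<..<n}" for t t' x
    using supp that by (simp add: K_def)

  have kD: "(k has_real_derivative deriv k x) (at x)" if "x \<in> I" for x
    using smooth_on_deriv[OF k that] .
  have k'D: "(deriv k has_real_derivative deriv (deriv k) x) (at x)" if "x \<in> I" for x
    using smooth_on_deriv[OF smooth_on_imp_smooth_on_deriv[OF I k] that] .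
  have deriv_K: "deriv (K t) x = (1 - s t) * deriv k x + s t * deriv (F (\<beta> t)) x" if "x \<in> I" for t x
  proof -
    have "smooth_on (F (\<beta> t)) I" unfolding F_def by (intro smooth_on_intros I k WV)
    then have FD: "(F (\<beta> t) has_real_derivative deriv (F (\<beta> t)) x) (at x)"
      using smooth_on_deriv that by blast
    show ?thesis unfolding KF
      by (rule DERIV_imp_deriv) (auto intro!: derivative_eq_intros kD[OF that] FD)
  qed
  have deriv_F: "deriv (F \<beta>) x = A * ((x - c) * (x - d) + \<beta>)" if "x \<in> {u<..<w}" for \<beta> x
  proof (rule DERIV_imp_deriv, rule has_field_derivative_transform_within_open[OF _ open_greaterThanLessThan that])
    show "((\<lambda>x. e + A * (x ^ 3 / 3 - (c + d) / 2 * x\<^sup>2 + c * d * x + \<beta> * (x - b)))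
        has_real_derivative A * ((x - c) * (x - d) + \<beta>)) (at x)"
      by (auto intro!: derivative_eq_intros simp: algebra_simps power2_eq_square)
  qed (simp add: cubic F_def)
  have K_pos_off: "0 < deriv (K t) x" if "x \<in> I" "x \<notin> {c..d}" for t x
  proof -
    have F: "0 < deriv (F (\<beta> t)) x" unfolding F_def using off_pos \<beta>01 that by blast
    show ?thesis
    proof (cases "s t = 0")
      case True
      then show ?thesis using pos that by (simp add: deriv_K)
    next
      case False
      then show ?thesis unfolding deriv_K[OF that(1)]
        using F pos[OF that] s01[of t] by (intro add_nonneg_pos) auto
    qed
  qed
  have deriv_K_near: "deriv (K t) x = (1 - s t) * deriv k x + s t * (A * ((x - c) * (x - d) + \<beta> t))"
    if "x \<in> {u<..<w}" for t x
    using that uw by (subst deriv_K) (auto simp: deriv_F)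
  have deriv2_K: "deriv (deriv (K t)) x = (1 - s t) * deriv (deriv k) x + s t * (A * (2 * x - (c + d)))"
    if "x \<in> {u<..<w}" for t x
  proof (rule DERIV_imp_deriv, rule has_field_derivative_transform_within_open[OF _ open_greaterThanLessThan that])
    show "((\<lambda>x. (1 - s t) * deriv k x + s t * (A * ((x - c) * (x - d) + \<beta> t)))
        has_real_derivative (1 - s t) * deriv (deriv k) x + s t * (A * (2 * x - (c + d)))) (at x)"
      using that uw by (auto intro!: derivative_eq_intros k'D simp: algebra_simps)
  qed (simp add: deriv_K_near)

  have k''c: "deriv (deriv k) c \<le> 0"
  proof (rule has_deriv_nonpos_if_decreasing_through[OF k'D \<open>c < d\<close>])
    show "deriv k x \<le> deriv k c" if "c < x" "x < d" for x
      using nonpos_iff[of x] zero_iff[of c] that by simp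
  qed fact
  have k''d: "0 \<le> deriv (deriv k) d"
  proof (rule has_deriv_nonneg_if_increasing_through[OF k'D \<open>d < n\<close>])
    fix x assume x: "d < x" "x < n"
    then have "x \<in> I"
      using mem_is_interval_1_I[OF assms(2,6,7)] by simp
    then show "deriv k d \<le> deriv k x"
      using pos[of x] zero_iff[of d] x by simp
  qed fact

  \<comment> \<open>the minimum of \<open>(x - c) * (x - d)\<close> is \<open>- \<beta>1 / 2\<close>\<close>
  have min: "(x - c) * (x - d) = (x - (c + d) / 2)\<^sup>2 - \<beta>1 / 2" for x
    by (simp add: \<beta>1_def power2_eq_square field_simps)
  have Morse: "Morse_on (K t) I" if t: "0 < t" "t < 3/2" for t
    unfolding Morse_on_def
  proof (intro conjI ballI impI smooth_K)
    fix x assume x: "x \<in> I" "deriv (K t) x = 0"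
    have cd: "x \<in> {c..d}" using K_pos_off[OF x(1), of t] x(2) by force
    with uw have xu: "x \<in> {u<..<w}" by blast
    have st: "0 < s t" using t by (simp add: s_def unit_step_pos)
    show "deriv (deriv (K t)) x \<noteq> 0"
    proof (cases "t \<le> 1")
      case True
      \<comment> \<open>two summands \<open>\<le> 0\<close> with sum \<open>0\<close>\<close>
      have "(1 - s t) * deriv k x + s t * (A * ((x - c) * (x - d))) = 0"
        using x(2) \<beta>_eq_0[OF True] by (simp add: deriv_K_near[OF xu])
      moreover have "(1 - s t) * deriv k x \<le> 0"
        using nonpos_iff[of x] cd s01[of t] by (simp add: mult_nonneg_nonpos)
      moreover have "s t * (A * ((x - c) * (x - d))) \<le> 0"
        using cd st A by (simp add: mult_nonneg_nonpos)
      ultimately have "s t * (A * ((x - c) * (x - d))) = 0" by linarith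
      then consider "x = c" | "x = d" using st A by auto
      then show ?thesis
      proof cases
        case 1
        have "(1 - s t) * deriv (deriv k) c \<le> 0"
          using k''c s01[of t] by (simp add: mult_nonneg_nonpos)
        moreover have "s t * (A * (2 * c - (c + d))) < 0"
          using st A \<open>c < d\<close> by (simp add: mult_pos_neg)
        ultimately show ?thesis using 1 deriv2_K[OF xu, of t] by simp
      next
        case 2
        have "0 \<le> (1 - s t) * deriv (deriv k) d"
          using k''d s01[of t] by simp
        moreover have "0 < s t * (A * (2 * d - (c + d)))"
          using st A \<open>c < d\<close> by simp
        ultimately show ?thesis using 2 deriv2_K[OF xu, of t] by simp
      qed
    next
      case False
      then have s1: "s t = 1" using s_eq_1 by simp
      have "\<beta> t < \<beta>1 / 2"
        using unit_step_less_half[of "t - 1"] t \<beta>1 by (simp add: \<beta>_def s_def)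
      moreover have "(x - c) * (x - d) + \<beta> t = 0"
        using x(2) s1 A by (simp add: deriv_K_near[OF xu])
      ultimately have "(x - (c + d) / 2)\<^sup>2 > 0" using min[of x] by linarith
      then have "2 * x - (c + d) \<noteq> 0" by auto
      then show ?thesis using s1 A by (simp add: deriv2_K[OF xu])
    qed
  qed
  have no_crit: "0 < deriv (K t) x" if "3/2 < t" "x \<in> I" for t x
  proof (cases "x \<in> {c..d}")
    case True
    then have xu: "x \<in> {u<..<w}" using uw by blast
    have "\<beta>1 / 2 < \<beta> t"
      using unit_step_greater_half[of "t - 1"] that \<beta>1 by (simp add: \<beta>_def s_def)
    moreover have "0 \<le> (x - (c + d) / 2)\<^sup>2" by simp
    ultimately have "0 < (x - c) * (x - d) + \<beta> t" using min[of x] by linarith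
    then show ?thesis using A s_eq_1[of t] that by (simp add: deriv_K_near[OF xu])
  qed (rule K_pos_off[OF that(2)])
  have poly: "\<exists>p :: real poly. degree p = 3 \<and> (\<forall>x\<in>{u<..<w}. K t x = poly p x)" if "1 \<le> t" for t
  proof (intro exI conjI ballI)
    let ?p = "[:e - A * \<beta> t * b, A * (c * d + \<beta> t), - A * (c + d) / 2, A / 3:]"
    show "degree ?p = 3" using A by simp
    show "K t x = poly ?p x" if "x \<in> {u<..<w}" for x
      unfolding KF F_def cubic[OF that] s_eq_1[OF \<open>1 \<le> t\<close>]
      by (simp add: field_simps power2_eq_square power3_eq_cube)
  qed
  show ?thesis
  proof (intro exI[of _ K] exI[of _ "3/2 :: real"] conjI allI impI ballI)
    show "\<exists>U. open U \<and> {c..d} \<subseteq> U \<and> U \<subseteq> I \<and>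
         (\<forall>t\<ge>1. \<exists>p :: real poly. degree p = 3 \<and> (\<forall>x\<in>U. K t x = poly p x))"
      using uw poly by (intro exI[of _ "{u<..<w}"]) auto
    show "{x \<in> I. deriv (K t) x \<le> 0} = {}" if "3/2 < t" for t
      using no_crit[OF that] by force
    show "K 0 x = k x" if "x \<in> I" for x
      by (simp add: K_def s_def s_simps)
  qed (use path mono fixed Morse in auto)
qed

end
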